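(* Let $n\ge 3$ and $1\le k\le\frac n2$. There exists a positive constant $C$, depending only on $n$ and $k$, such that for every $v\in\Phi^k(B_3)$, $$\sup_{B_1}v\le C\,\|v\|_{L^1(B_2)} .$$
   Context: $B_r$ denotes the ball of radius $r$ centered at the origin of $\mathbb{R}^n$. For $\lambda\in\mathbb{R}^n$, $\sigma_i(\lambda)$ is the $i$-th elementary symmetric polynomial and $\Gamma_k=\{\lambda\in\mathbb{R}^n:\sigma_i(\lambda)\ge 0\ \text{for all } 1\le i\le k\}$. For a positive $C^2$ function $v$, $A_{ij}(v)=v\,v_{ij}-\frac12|\nabla v|^2\delta_{ij}$ and $\lambda\{A_{ij}(v)\}$ is the vector of eigenvalues of $(A_{ij}(v))$. $\tilde\Phi^k(\Omega)=\{u\in C^2(\Omega): u>0,\ \lambda\{A_{ij}(u)\}\in\Gamma_k \text{ in } \Omega\}$. $\Phi^k(\Omega)$ is the set of $u\in L^1_{loc}(\Omega)$ with $u>0$ for which there exists a sequence $\{u^{(m)}\}\subset\tilde\Phi^k(\Omega)$ such that $u^{(m)}\to u$ in $L^1_{loc}(\Omega)$. Since elements of $\Phi^k$ are $L^1_{loc}$ functions, the supremum is the essential supremum. *)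

theory Defs
  imports "HOL-Analysis.Analysis" "HOL-Probability.Essential_Supremum"
begin

definition partial_deriv :: "'n \<Rightarrow> (real ^ 'n \<Rightarrow> real) \<Rightarrow> real ^ 'n \<Rightarrow> real" where
  "partial_deriv i f x = frechet_derivative f (at x) (axis i 1)"

text \<open>The next two notions, and everything built on them, are meant for open \<open>\<Omega>\<close>;
  the values of \<open>f\<close> outside \<open>\<Omega>\<close> are irrelevant.\<close>

definition C1_on :: "(real ^ 'n) set \<Rightarrow> (real ^ 'n \<Rightarrow> real) \<Rightarrow> bool" where
  "C1_on \<Omega> f \<longleftrightarrow>
     (\<forall>x\<in>\<Omega>. f differentiable (at x)) \<and> (\<forall>i. continuous_on \<Omega> (partial_deriv i f))"

definition C2_on :: "(real ^ 'n) set \<Rightarrow> (real ^ 'n \<Rightarrow> real) \<Rightarrow> bool" where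
  "C2_on \<Omega> f \<longleftrightarrow> C1_on \<Omega> f \<and> (\<forall>i. C1_on \<Omega> (partial_deriv i f))"

definition gradient :: "(real ^ 'n \<Rightarrow> real) \<Rightarrow> real ^ 'n \<Rightarrow> real ^ 'n" where
  "gradient f x = (\<chi> i. partial_deriv i f x)"

definition A_matrix :: "(real ^ 'n \<Rightarrow> real) \<Rightarrow> real ^ 'n \<Rightarrow> real ^ 'n ^ 'n" where
  "A_matrix v x =
     (\<chi> i j. v x * partial_deriv j (partial_deriv i v) x
             - 1 / 2 * (norm (gradient v x))\<^sup>2 * (if i = j then 1 else 0))"

definition esym :: "nat \<Rightarrow> real ^ 'n \<Rightarrow> real" where
  "esym i l = (\<Sum>I | I \<subseteq> UNIV \<and> card I = i. \<Prod>j\<in>I. l $ j)"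

definition Gamma_cone :: "nat \<Rightarrow> (real ^ 'n) set" where
  "Gamma_cone k = {l. \<forall>i. 1 \<le> i \<and> i \<le> k \<longrightarrow> 0 \<le> esym i l}"

text \<open>\<open>l\<close> lists the eigenvalues of \<open>A\<close> with algebraic multiplicity, i.e.\ it lists the roots
  of the characteristic polynomial.  Such a vector is unique up to a permutation of its entries
  (and exists when \<open>A\<close> is symmetric), and \<^const>\<open>Gamma_cone\<close> is invariant under permutations;
  so in \<open>Phi_tilde\<close> it does not matter which ordering of the eigenvalues is used.\<close>

definition eigenvalue_vector :: "real ^ 'n ^ 'n \<Rightarrow> real ^ 'n \<Rightarrow> bool" where
  "eigenvalue_vector A l \<longleftrightarrow> (\<forall>t. det (mat t - A) = (\<Prod>i\<in>UNIV. t - l $ i))"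

definition Phi_tilde :: "nat \<Rightarrow> (real ^ 'n) set \<Rightarrow> (real ^ 'n \<Rightarrow> real) set" where
  "Phi_tilde k \<Omega> =
     {u. C2_on \<Omega> u \<and> (\<forall>x\<in>\<Omega>. 0 < u x) \<and>
         (\<forall>x\<in>\<Omega>. \<exists>l. eigenvalue_vector (A_matrix u x) l \<and> l \<in> Gamma_cone k)}"

definition L1_loc :: "(real ^ 'n) set \<Rightarrow> (real ^ 'n \<Rightarrow> real) set" where
  "L1_loc \<Omega> = {u. \<forall>K. compact K \<and> K \<subseteq> \<Omega> \<longrightarrow> set_integrable lebesgue K u}"

definition tendsto_L1_loc ::
    "(real ^ 'n) set \<Rightarrow> (nat \<Rightarrow> real ^ 'n \<Rightarrow> real) \<Rightarrow> (real ^ 'n \<Rightarrow> real) \<Rightarrow> bool" where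
  "tendsto_L1_loc \<Omega> us u \<longleftrightarrow>
     (\<forall>K. compact K \<and> K \<subseteq> \<Omega> \<longrightarrow>
        (\<lambda>m. LINT x:K|lebesgue. \<bar>us m x - u x\<bar>) \<longlonglongrightarrow> 0)"

text \<open>Members of \<open>L1_loc\<close> are functions representing their almost-everywhere class, so
  positivity of an element of \<open>Phi\<close> is required almost everywhere only.\<close>

definition Phi :: "nat \<Rightarrow> (real ^ 'n) set \<Rightarrow> (real ^ 'n \<Rightarrow> real) set" where
  "Phi k \<Omega> =
     {u \<in> L1_loc \<Omega>. (AE x in lebesgue_on \<Omega>. 0 < u x) \<and>
        (\<exists>us. (\<forall>m. us m \<in> Phi_tilde k \<Omega>) \<and> tendsto_L1_loc \<Omega> us u)}"

end

theory Submission imports Defs begin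

text \<open>
  Membership of the eigenvalues in \<^const>\<open>Gamma_cone\<close> says in particular that their first
  symmetric polynomial, the trace of the matrix, is nonnegative:
  \<open>v \<Delta>v - (n/2) |\<nabla>v|\<^sup>2 \<ge> 0\<close>.  As \<open>v > 0\<close>, this forces \<open>\<Delta>v \<ge> 0\<close>
  (\<open>Phi_tilde_imp_laplacian_nonneg\<close>), so every element of \<^const>\<open>Phi_tilde\<close> is
  subharmonic, and the estimate is the sub-mean value inequality on balls of radius \<open>1\<close>
  centred in the unit ball, which all lie in the ball of radius \<open>2\<close>.

  Only some constant is wanted, so the mean may be taken with a convenient weight.
  For \<open>w(y) = max(0, \<rho>\<^sup>2 - |y|\<^sup>2)\<close> one has \<open>\<nabla>(w\<^sup>2) = - 4 w(y) y\<close>, and therefore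
  \<open>\<phi>(r) = \<integral> w(y) u(x + r y) dy\<close> satisfies, after an integration by parts,
  \<open>\<phi>'(r) = \<integral> w(y) \<nabla>u(x + r y) \<cdot> y dy = (r/4) \<integral> w(y)\<^sup>2 \<Delta>u(x + r y) dy \<ge> 0\<close>.
  Comparing \<open>\<phi>(0) = u(x) \<integral> w\<close> with \<open>\<phi>(1) \<le> \<rho>\<^sup>2 \<integral> u\<close> gives the bound
  (\<open>weighted_sub_mean_value\<close>, \<open>subharmonic_le_L1_norm\<close>).  The weight vanishes on the boundary of
  its support, so the integration by parts has no boundary term and needs no surface integral: it
  reduces to the vanishing of \<open>\<integral> \<partial>F/\<partial>e\<close> for compactly supported \<open>F\<close>, which is the derivative
  of the translation-invariant quantity \<open>\<integral> F(y + t e) dy\<close>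
  (\<open>integral_directional_derivative_eq_0\<close>).

  For a general element of \<^const>\<open>Phi\<close>, the approximating functions converge in \<open>L\<^sup>1\<close> on the
  unit ball and the constants bounding them there converge, so the bound survives almost everywhere
  (\<open>AE_le_of_L1_limit\<close>).
\<close>

section \<open>The trace as the sum of the eigenvalues\<close>

lemma det_scaleR_matrix: "det (c *\<^sub>R A) = c ^ CARD('n) * det (A :: real ^ 'n ^ 'n)"
  by (simp add: det_def prod.distrib sum_distrib_left mult_ac)

text \<open>In the Leibniz expansion, a permutation other than the identity moves at least two indices
  and so contributes a product with two factors vanishing at \<open>0\<close>; only the diagonal product
  has a derivative there.\<close>

lemma has_field_derivative_det_id_minus:
  fixes A :: "real ^ 'n ^ 'n"
  shows "((\<lambda>s. det (mat 1 - s *\<^sub>R A)) has_field_derivative - trace A) (at 0)"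
proof -
  define \<delta> :: "'n \<Rightarrow> 'n \<Rightarrow> real" where "\<delta> i j = (if i = j then 1 else 0)" for i j
  define P where "P = {p. p permutes (UNIV :: 'n set)}"
  have fin: "finite P"
    by (simp add: P_def)
  define D where "D p = (\<Sum>i\<in>UNIV. - A $ i $ p i * (\<Prod>j\<in>UNIV - {i}. \<delta> j (p j) - 0 * A $ j $ p j))"
    for p :: "'n \<Rightarrow> 'n"
  have deriv: "((\<lambda>s. \<Prod>i\<in>UNIV. \<delta> i (p i) - s * A $ i $ p i) has_field_derivative D p) (at 0)"
    for p :: "'n \<Rightarrow> 'n"
    unfolding D_def
    by (rule has_field_derivative_prod) (auto intro!: derivative_eq_intros)
  have D0: "D p = 0" if "p \<in> P" "p \<noteq> id" for p
  proof -
    have inj: "inj p"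
      using \<open>p \<in> P\<close> by (auto simp: P_def permutes_inj)
    obtain a where a: "p a \<noteq> a"
      using \<open>p \<noteq> id\<close> by (metis eq_id_iff)
    hence b: "p (p a) \<noteq> p a"
      using inj by (metis injD)
    \<comment> \<open>Differentiating one factor of the product still leaves a vanishing one.\<close>
    have "\<exists>j\<in>UNIV - {i}. \<delta> j (p j) = 0" for i
    proof -
      have "\<delta> a (p a) = 0" "\<delta> (p a) (p (p a)) = 0"
        using a b by (simp_all add: \<delta>_def)
      thus ?thesis
        using a by (cases "i = a") blast+
    qed
    hence "(\<Prod>j\<in>UNIV - {i}. \<delta> j (p j)) = 0" for i
      by (meson finite_class.finite_UNIV finite_Diff prod_zero)
    thus ?thesis
      by (simp add: D_def del: prod_zero_iff)
  qed
  have Did: "D id = - trace A"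
    by (simp add: D_def \<delta>_def trace_def sum_negf)
  have "((\<lambda>s. \<Sum>p\<in>P. of_int (sign p) * (\<Prod>i\<in>UNIV. \<delta> i (p i) - s * A $ i $ p i))
      has_field_derivative (\<Sum>p\<in>P. of_int (sign p) * D p)) (at 0)"
    by (intro DERIV_sum DERIV_cmult deriv)
  also have "(\<Sum>p\<in>P. of_int (sign p) * D p) = (\<Sum>p\<in>{id}. of_int (sign p) * D p)"
    by (rule sum.mono_neutral_right) (auto simp: fin D0, auto simp: P_def permutes_id)
  also have "\<dots> = - trace A"
    by (simp add: Did)
  finally show ?thesis
    by (simp add: det_def P_def \<delta>_def mat_def)
qed

text \<open>The substitution \<open>t = 1/s\<close> turns the factorization of \<open>det (t - A)\<close> into one of
  \<open>det (1 - s A)\<close>; the second coefficient can then be read off as a derivative at \<open>s = 0\<close>.\<close>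

lemma trace_eq_sum_eigenvalue_vector:
  fixes A :: "real ^ 'n ^ 'n"
  assumes "eigenvalue_vector A l"
  shows "trace A = (\<Sum>i\<in>UNIV. l $ i)"
proof -
  have eq: "det (mat 1 - s *\<^sub>R A) = (\<Prod>i\<in>UNIV. 1 - s * l $ i)" for s
  proof (cases "s = 0")
    case False
    have "mat 1 - s *\<^sub>R A = s *\<^sub>R (mat (1 / s) - A)"
      using False by (simp add: vec_eq_iff mat_def algebra_simps)
    hence "det (mat 1 - s *\<^sub>R A) = s ^ CARD('n) * (\<Prod>i\<in>UNIV. 1 / s - l $ i)"
      using assms by (simp add: det_scaleR_matrix eigenvalue_vector_def)
    also have "\<dots> = (\<Prod>i\<in>UNIV. s * (1 / s - l $ i))"
      by (simp add: prod.distrib)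
    finally show ?thesis
      using False by (simp add: right_diff_distrib)
  qed simp
  have "((\<lambda>s. \<Prod>i\<in>UNIV. 1 - s * l $ i) has_field_derivative
      (\<Sum>i\<in>UNIV. - l $ i * (\<Prod>j\<in>UNIV - {i}. 1 - 0 * l $ j))) (at 0)"
    by (rule has_field_derivative_prod) (auto intro!: derivative_eq_intros)
  hence "((\<lambda>s. det (mat 1 - s *\<^sub>R A)) has_field_derivative - (\<Sum>i\<in>UNIV. l $ i)) (at 0)"
    by (simp add: eq sum_negf)
  from DERIV_unique[OF this has_field_derivative_det_id_minus] show ?thesis
    by simp
qed

lemma esym_1: "esym (Suc 0) l = (\<Sum>i\<in>UNIV. l $ i)"
proof -
  have "{I. I \<subseteq> (UNIV :: 'a set) \<and> card I = Suc 0} = (\<lambda>i. {i}) ` UNIV"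
    by (auto simp: card_Suc_eq)
  thus ?thesis
    by (simp add: esym_def sum.reindex)
qed

definition laplacian :: "(real ^ 'n \<Rightarrow> real) \<Rightarrow> real ^ 'n \<Rightarrow> real" where
  "laplacian u x = (\<Sum>i\<in>UNIV. partial_deriv i (partial_deriv i u) x)"

lemma Phi_tilde_imp_laplacian_nonneg:
  assumes "1 \<le> k" "u \<in> Phi_tilde k \<Omega>" "x \<in> \<Omega>"
  shows "0 \<le> laplacian u x"
proof -
  obtain l where l: "eigenvalue_vector (A_matrix u x) l" "l \<in> Gamma_cone k" and pos: "0 < u x"
    using assms by (auto simp: Phi_tilde_def)
  have "0 \<le> esym (Suc 0) l"
    using l(2) assms(1) by (auto simp: Gamma_cone_def)
  hence "0 \<le> trace (A_matrix u x)"
    using trace_eq_sum_eigenvalue_vector[OF l(1)] by (simp add: esym_1)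
  also have "\<dots> = u x * laplacian u x - real CARD('a) * (1 / 2 * (norm (gradient u x))\<^sup>2)"
    by (simp add: trace_def A_matrix_def laplacian_def sum_subtractf sum_distrib_left)
  also have "\<dots> \<le> u x * laplacian u x"
    by simp
  finally show ?thesis
    using pos by (simp add: zero_le_mult_iff)
qed

section \<open>Integration by parts against a compactly supported function\<close>

text \<open>The integral of \<open>F (y + t e)\<close> over all \<open>y\<close> does not depend on \<open>t\<close>, and the integral in
  question is its derivative at \<open>t = 0\<close>.\<close>

lemma integral_directional_derivative_eq_0:
  fixes F :: "'a::euclidean_space \<Rightarrow> real" and a b :: 'a
  assumes F: "\<And>y. (F has_derivative F' y) (at y)"
    and cont: "continuous_on UNIV (\<lambda>y. F' y e)"
    and supp: "\<And>y. R \<le> norm y \<Longrightarrow> F y = 0" "\<And>y. R \<le> norm y \<Longrightarrow> F' y e = 0"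
    and Q: "cball 0 R \<subseteq> cbox a b"
  shows "((\<lambda>y. F' y e) has_integral 0) (cbox a b)"
proof -
  \<comment> \<open>The margin \<open>norm e\<close> keeps the support inside the box under every shift by \<open>t e\<close>
    with \<open>\<bar>t\<bar> \<le> 1\<close>, so differentiation under the integral happens on a compact set.\<close>
  obtain c :: 'a where c: "cball 0 (R + norm e) \<subseteq> cbox (- c) c"
    using bounded_subset_cbox_symmetric bounded_cball by blast
  define h where "h t = integral (cbox (- c) c) (\<lambda>y. F (y + t *\<^sub>R e))" for t :: real
  have contF: "continuous_on S F" for S
    by (meson F has_derivative_continuous continuous_at_imp_continuous_on)
  have h: "h t = integral UNIV F" if "t \<in> {-1..1}" for t
  proof -
    have sub: "cball 0 R \<subseteq> cbox (- c + t *\<^sub>R e) (c + t *\<^sub>R e)"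
    proof
      fix y :: 'a assume y: "y \<in> cball 0 R"
      have "norm (y - t *\<^sub>R e) \<le> norm y + \<bar>t\<bar> * norm e"
        by (metis norm_scaleR norm_triangle_ineq4)
      also have "\<dots> \<le> R + 1 * norm e"
        using y that by (intro add_mono mult_right_mono) auto
      finally have "y - t *\<^sub>R e \<in> cbox (- c) c"
        using c by auto
      thus "y \<in> cbox (- c + t *\<^sub>R e) (c + t *\<^sub>R e)"
        by (auto simp: mem_box inner_diff_left inner_add_left algebra_simps)
    qed
    have "h t = integral (cbox (- c + t *\<^sub>R e) (c + t *\<^sub>R e)) F"
      using integral_shift_cbox[of "- c + t *\<^sub>R e" "t *\<^sub>R e" "c + t *\<^sub>R e" F] by (simp add: h_def)
    also have "\<dots> = integral UNIV F"
    proof (rule integral_unique[symmetric], rule has_integral_on_superset)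
      show "(F has_integral integral (cbox (- c + t *\<^sub>R e) (c + t *\<^sub>R e)) F)
          (cbox (- c + t *\<^sub>R e) (c + t *\<^sub>R e))"
        by (intro integrable_integral integrable_continuous contF)
      show "F y = 0" if "y \<notin> cbox (- c + t *\<^sub>R e) (c + t *\<^sub>R e)" for y
        using that sub supp(1)[of y] by force
    qed simp
    finally show ?thesis .
  qed
  have "(h has_field_derivative integral (cbox (- c) c) (\<lambda>y. F' (y + 0 *\<^sub>R e) e))
      (at 0 within {-1..1})"
    unfolding h_def
  proof (rule leibniz_rule_field_derivative[where fx = "\<lambda>t y. F' (y + t *\<^sub>R e) e"])
    show "((\<lambda>t. F (y + t *\<^sub>R e)) has_field_derivative F' (y + t *\<^sub>R e) e) (at t within {-1..1})"
      for t y
    proof -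
      have "((\<lambda>t. F (y + t *\<^sub>R e)) has_derivative (\<lambda>s. F' (y + t *\<^sub>R e) (s *\<^sub>R e)))
          (at t within {-1..1})"
        by (rule has_derivative_compose[OF _ F]) (auto intro!: derivative_eq_intros)
      moreover have "F' z (s *\<^sub>R e) = F' z e * s" for z s
        using has_derivative_linear[OF F] by (simp add: linear_scale)
      ultimately show ?thesis
        by (simp add: has_field_derivative_def)
    qed
    show "continuous_on ({-1..1} \<times> cbox (- c) c) (\<lambda>(t, y). F' (y + t *\<^sub>R e) e)"
      unfolding split_beta
      by (rule continuous_on_compose2[OF cont]) (auto intro!: continuous_intros)
    show "(\<lambda>y. F (y + t *\<^sub>R e)) integrable_on cbox (- c) c" for t
      by (intro integrable_continuous continuous_on_compose2[OF contF[of UNIV]] continuous_intros)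
        auto
  qed auto
  moreover have "(h has_field_derivative 0) (at 0 within {-1..1})"
    by (rule has_field_derivative_transform_within[OF _ zero_less_one, of "\<lambda>_. integral UNIV F"])
      (auto simp: h)
  moreover have "at (0::real) within {-1..1} = at 0"
    by (rule at_within_interior) auto
  ultimately have "integral (cbox (- c) c) (\<lambda>y. F' y e) = 0"
    by (simp add: DERIV_unique)
  hence "((\<lambda>y. F' y e) has_integral 0) (cbox (- c) c)"
    by (metis cont continuous_on_subset integrable_continuous integrable_integral subset_UNIV)
  hence "((\<lambda>y. F' y e) has_integral 0) UNIV"
  proof (rule has_integral_on_superset)
    fix y assume "y \<notin> cbox (- c) c"
    hence "\<not> norm y \<le> R + norm e"
      using c by auto
    thus "F' y e = 0"
      using norm_ge_zero[of e] by (intro supp(2)) linarith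
  qed simp
  moreover have "(\<lambda>y. if y \<in> cbox a b then F' y e else 0) = (\<lambda>y. F' y e)"
    using Q supp(2) by (auto simp: fun_eq_iff subset_iff) (metis linear)
  ultimately show ?thesis
    by (simp flip: has_integral_restrict_UNIV[of "cbox a b"])
qed

text \<open>The product \<open>\<psi> g\<close>, extended by zero, is differentiable on the whole space: \<open>S\<close> and the
  exterior of the ball form an open cover, and on the exterior the product vanishes identically.
  In this way \<open>g\<close> only has to be differentiable on \<open>S\<close>.\<close>

lemma integration_by_parts_cutoff:
  fixes g \<psi> :: "'a::euclidean_space \<Rightarrow> real"
  assumes S: "open S" "cbox a b \<subseteq> S" and Q: "cball 0 R \<subseteq> cbox a b"
    and g: "\<And>y. y \<in> S \<Longrightarrow> (g has_derivative g' y) (at y)"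
    and g': "continuous_on S (\<lambda>y. g' y e)"
    and \<psi>: "\<And>y. (\<psi> has_derivative \<psi>' y) (at y)"
    and \<psi>': "continuous_on UNIV (\<lambda>y. \<psi>' y e)"
    and supp: "\<And>y. R \<le> norm y \<Longrightarrow> \<psi> y = 0" "\<And>y. R \<le> norm y \<Longrightarrow> \<psi>' y e = 0"
  shows "((\<lambda>y. \<psi>' y e * g y + \<psi> y * g' y e) has_integral 0) (cbox a b)"
proof -
  define F' where "F' y h = (if y \<in> S then \<psi>' y h * g y + \<psi> y * g' y h else 0)" for y h
  have F: "((\<lambda>y. \<psi> y * g y) has_derivative F' y) (at y)" for y
  proof (cases "y \<in> S")
    case True
    show ?thesis
      using has_derivative_mult[OF \<psi> g[OF True]] True by (simp add: F'_def[abs_def] add.commute)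
  next
    case False
    have "((\<lambda>y. \<psi> y * g y) has_derivative (\<lambda>_. 0)) (at y)"
      by (rule has_derivative_transform_within_open[of "\<lambda>_. 0" _ _ _ "- cball 0 R"])
        (use False S Q supp in auto)
    thus ?thesis
      using False by (simp add: F'_def[abs_def])
  qed
  have cont: "continuous_on UNIV (\<lambda>y. F' y e)"
  proof -
    have "continuous_on S (\<lambda>y. \<psi>' y e * g y + \<psi> y * g' y e)"
      by (intro continuous_intros g' continuous_on_subset[OF \<psi>'] subset_UNIV
          continuous_at_imp_continuous_on ballI has_derivative_continuous[OF \<psi>]
          has_derivative_continuous[OF g])
    hence "continuous_on S (\<lambda>y. F' y e)"
      by (rule continuous_on_eq) (simp add: F'_def)
    moreover have "continuous_on (- cball 0 R) (\<lambda>y. F' y e)"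
      by (rule continuous_on_eq[OF continuous_on_const[of _ 0]]) (simp add: F'_def supp)
    ultimately have "continuous_on (S \<union> - cball 0 R) (\<lambda>y. F' y e)"
      using S(1) by (intro continuous_on_open_Un) auto
    moreover have "S \<union> - cball 0 R = UNIV"
      using S Q by auto
    ultimately show ?thesis
      by simp
  qed
  have "((\<lambda>y. F' y e) has_integral 0) (cbox a b)"
    by (rule integral_directional_derivative_eq_0[OF F cont _ _ Q]) (auto simp: F'_def supp)
  thus ?thesis
    by (rule has_integral_eq[rotated]) (use S in \<open>auto simp: F'_def\<close>)
qed

section \<open>A sub-mean value inequality\<close>

lemma has_field_derivative_max_0_squared:
  "((\<lambda>s::real. (max 0 s)\<^sup>2) has_field_derivative 2 * max 0 s) (at s)"
proof -
  consider "s > 0" | "s < 0" | "s = 0"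
    by linarith
  thus ?thesis
  proof cases
    assume "s > 0"
    hence "((\<lambda>s::real. s\<^sup>2) has_field_derivative 2 * max 0 s) (at s)"
      by (auto intro!: derivative_eq_intros)
    thus ?thesis
      by (rule has_field_derivative_transform_within_open[of _ _ _ "{0<..}"]) (use \<open>s > 0\<close> in auto)
  next
    assume "s < 0"
    hence "((\<lambda>s::real. 0) has_field_derivative 2 * max 0 s) (at s)"
      by (auto intro!: derivative_eq_intros)
    thus ?thesis
      by (rule has_field_derivative_transform_within_open[of _ _ _ "{..<0}"]) (use \<open>s < 0\<close> in auto)
  next
    assume s: "s = 0"
    have "(\<lambda>t::real. (max 0 t)\<^sup>2 / t) = max 0"
      by (auto simp: fun_eq_iff max_def power2_eq_square)
    moreover have "(max 0 \<longlongrightarrow> (0::real)) (at 0)"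
      by (intro tendsto_eq_intros) auto
    ultimately show ?thesis
      by (simp add: s has_field_derivative_iff)
  qed
qed

text \<open>Up to a constant factor, the weight is the one for which \<open>weight \<rho> y *\<^sub>R y\<close> is the gradient
  of a compactly supported \<open>C\<^sup>1\<close> function, namely of the square of the weight.\<close>

definition weight :: "real \<Rightarrow> 'a::real_inner \<Rightarrow> real" where
  "weight \<rho> y = max 0 (\<rho>\<^sup>2 - y \<bullet> y)"

lemma weight_nonneg: "0 \<le> weight \<rho> y"
  and weight_le: "weight \<rho> y \<le> \<rho>\<^sup>2"
  by (simp_all add: weight_def)

lemma weight_eq_0: "weight \<rho> y = 0" if "0 \<le> \<rho>" "\<rho> \<le> norm y"
  using that power_mono[of \<rho> "norm y" 2] by (simp add: weight_def power2_norm_eq_inner)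

lemma continuous_on_weight [continuous_intros]: "continuous_on S (weight \<rho>)"
  unfolding weight_def by (intro continuous_intros)

lemma has_derivative_weight_squared:
  "((\<lambda>y. (weight \<rho> y)\<^sup>2) has_derivative (\<lambda>h. - 4 * weight \<rho> y * (y \<bullet> h))) (at y)"
proof -
  have "((\<lambda>y. \<rho>\<^sup>2 - y \<bullet> y) has_derivative (\<lambda>h. - 2 * (y \<bullet> h))) (at y)"
    by (auto intro!: derivative_eq_intros simp: inner_commute)
  from has_derivative_compose[OF this
      has_field_derivative_max_0_squared[unfolded has_field_derivative_def]]
  show ?thesis
    by (simp add: weight_def[abs_def] mult_ac)
qed

lemma has_derivative_partial_deriv:
  assumes "u differentiable (at x)"
  shows "(u has_derivative (\<lambda>h. \<Sum>i\<in>UNIV. h $ i * partial_deriv i u x)) (at x)"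
proof -
  have D: "(u has_derivative frechet_derivative u (at x)) (at x)"
    using assms by (simp add: frechet_derivative_works)
  interpret linear "frechet_derivative u (at x)"
    by (rule has_derivative_linear[OF D])
  have "frechet_derivative u (at x) h = (\<Sum>i\<in>UNIV. h $ i * partial_deriv i u x)" for h
  proof -
    have "h = (\<Sum>i\<in>UNIV. h $ i *\<^sub>R axis i 1)"
      using basis_expansion[of h] by (simp add: scalar_mult_eq_scaleR)
    hence "frechet_derivative u (at x) h = frechet_derivative u (at x) (\<Sum>i\<in>UNIV. h $ i *\<^sub>R axis i 1)"
      by simp
    thus ?thesis
      by (simp add: sum scale partial_deriv_def)
  qed
  hence "frechet_derivative u (at x) = (\<lambda>h. \<Sum>i\<in>UNIV. h $ i * partial_deriv i u x)"
    by (rule ext)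
  thus ?thesis
    using D by simp
qed

lemma C2_on_continuous_on:
  assumes "C2_on \<Omega> u"
  shows "continuous_on \<Omega> u"
  using assms by (meson C1_on_def C2_on_def continuous_at_imp_continuous_on
      differentiable_imp_continuous_within)

text \<open>The weighted mean of \<open>u (x + r y)\<close> over \<open>y\<close> is nondecreasing in \<open>r \<in> [0, 1]\<close>; the two
  sides are its values at \<open>r = 0\<close> and \<open>r = 1\<close>.  The integrals run over a box between the support
  of the weight and the unit ball, on which all the points \<open>x + r y\<close> stay in the domain of
  \<open>u\<close>.\<close>

lemma weighted_sub_mean_value:
  fixes u :: "real ^ 'n \<Rightarrow> real"
  assumes \<Omega>: "open \<Omega>" "ball x 1 \<subseteq> \<Omega>" and u: "C2_on \<Omega> u"
    and lap: "\<And>z. z \<in> \<Omega> \<Longrightarrow> 0 \<le> laplacian u z"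
    and \<rho>: "0 \<le> \<rho>" "cball 0 \<rho> \<subseteq> cbox a b" and Q: "cbox a b \<subseteq> ball 0 1"
  shows "u x * integral (cbox a b) (weight \<rho>)
    \<le> integral (cbox a b) (\<lambda>y. weight \<rho> y * u (x + y))"
proof -
  define h where "h r = integral (cbox a b) (\<lambda>y. weight \<rho> y * u (x + r *\<^sub>R y))" for r
  define P where "P r y = weight \<rho> y * (\<Sum>i\<in>UNIV. y $ i * partial_deriv i u (x + r *\<^sub>R y))" for r y
  have mem: "x + r *\<^sub>R y \<in> \<Omega>" if "r \<in> {0..1}" "y \<in> cbox a b" for r y
  proof -
    have "norm (r *\<^sub>R y) \<le> 1 * norm y"
      using that mult_right_mono[of r 1 "norm y"] by simp
    also have "\<dots> < 1"
      using that Q by auto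
    finally show ?thesis
      using \<Omega>(2) by (auto simp: dist_norm)
  qed
  have diff: "u differentiable (at z)" "partial_deriv i u differentiable (at z)" if "z \<in> \<Omega>" for z i
    using u that by (auto simp: C2_on_def C1_on_def)
  have cont: "continuous_on \<Omega> (partial_deriv i u)"
      "continuous_on \<Omega> (partial_deriv j (partial_deriv i u))" for i j
    using u by (auto simp: C2_on_def C1_on_def)
  have contP: "continuous_on ({0..1} \<times> cbox a b) (\<lambda>(r, y). P r y)"
    unfolding P_def split_beta
    by (intro continuous_intros continuous_on_compose2[OF cont(1)]
        continuous_on_compose2[OF continuous_on_weight[of UNIV]]) (auto simp: mem)
  have P_integrable: "P r integrable_on cbox a b" if "r \<in> {0..1}" for r
  proof (rule integrable_continuous)
    show "continuous_on (cbox a b) (P r)"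
    proof -
      have "continuous_on (cbox a b) (\<lambda>y. (\<lambda>(r, y). P r y) (r, y))"
        by (rule continuous_on_compose2[OF contP]) (use that in \<open>auto intro!: continuous_intros\<close>)
      thus ?thesis
        by simp
    qed
  qed
  have deriv: "(h has_field_derivative integral (cbox a b) (P r)) (at r within {0..1})"
    if r: "r \<in> {0..1}" for r
    unfolding h_def
  proof (rule leibniz_rule_field_derivative[OF _ _ contP r])
    fix t :: real and y assume ty: "t \<in> {0..1}" "y \<in> cbox a b"
    have "((\<lambda>t. u (x + t *\<^sub>R y)) has_derivative
        (\<lambda>s. \<Sum>i\<in>UNIV. (s *\<^sub>R y) $ i * partial_deriv i u (x + t *\<^sub>R y))) (at t within {0..1})"
      by (rule has_derivative_compose[OF _ has_derivative_partial_deriv])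
        (use ty in \<open>auto intro!: derivative_eq_intros diff mem\<close>)
    hence "((\<lambda>t. u (x + t *\<^sub>R y)) has_field_derivative
        (\<Sum>i\<in>UNIV. y $ i * partial_deriv i u (x + t *\<^sub>R y))) (at t within {0..1})"
      by (rule has_derivative_imp_has_field_derivative) (simp add: sum_distrib_left mult_ac)
    thus "((\<lambda>t. weight \<rho> y * u (x + t *\<^sub>R y)) has_field_derivative P t y) (at t within {0..1})"
      unfolding P_def by (rule DERIV_cmult)
  next
    fix t :: real assume "t \<in> {0..1}"
    thus "(\<lambda>y. weight \<rho> y * u (x + t *\<^sub>R y)) integrable_on cbox a b"
      by (intro integrable_continuous continuous_intros
          continuous_on_compose2[OF C2_on_continuous_on[OF u]]) (auto simp: mem)
  qed auto
  have nonneg: "0 \<le> integral (cbox a b) (P r)" if r: "r \<in> {0..1}" for r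
  proof -
    define T where "T = {y. x + r *\<^sub>R y \<in> \<Omega>}"
    have "open ((\<lambda>y. x + r *\<^sub>R y) -` \<Omega>)"
      by (intro open_vimage \<Omega>(1) continuous_intros)
    hence T: "open T" "cbox a b \<subseteq> T"
      using mem[OF r] by (auto simp: T_def vimage_def)
    have parts: "((\<lambda>y. - 4 * weight \<rho> y * (y \<bullet> axis i 1) * partial_deriv i u (x + r *\<^sub>R y) +
        (weight \<rho> y)\<^sup>2 *
          (\<Sum>j\<in>UNIV. (r *\<^sub>R axis i 1) $ j * partial_deriv j (partial_deriv i u) (x + r *\<^sub>R y)))
        has_integral 0) (cbox a b)" for i
    proof (rule integration_by_parts_cutoff[OF T \<rho>(2) _ _ has_derivative_weight_squared])
      show "((\<lambda>y. partial_deriv i u (x + r *\<^sub>R y)) has_derivative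
          (\<lambda>h. \<Sum>j\<in>UNIV. (r *\<^sub>R h) $ j * partial_deriv j (partial_deriv i u) (x + r *\<^sub>R y))) (at y)"
        if "y \<in> T" for y
        by (rule has_derivative_compose[OF _ has_derivative_partial_deriv])
          (use that in \<open>auto intro!: derivative_eq_intros diff simp: T_def\<close>)
    qed (auto intro!: continuous_intros continuous_on_compose2[OF cont(2)]
          simp: T_def weight_eq_0 \<rho>(1))
    \<comment> \<open>Summing over the coordinate directions and changing the sign turns the integrations by
      parts into \<open>4 \<integral> P = r \<integral> weight\<^sup>2 \<Delta>u\<close>.\<close>
    have "((\<lambda>y. 4 * P r y - r * (weight \<rho> y)\<^sup>2 * laplacian u (x + r *\<^sub>R y)) has_integral 0)
        (cbox a b)"
    proof -
      have axis: "(\<Sum>j\<in>UNIV. (r *\<^sub>R axis i 1) $ j * c j) = r * c i" for i :: 'n and c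
        by (simp add: axis_def if_distrib if_distribR cong: if_cong)
      have "((\<lambda>y. - (\<Sum>i\<in>UNIV. - 4 * weight \<rho> y * (y \<bullet> axis i 1) * partial_deriv i u (x + r *\<^sub>R y) +
          (weight \<rho> y)\<^sup>2 *
          (\<Sum>j\<in>UNIV. (r *\<^sub>R axis i 1) $ j * partial_deriv j (partial_deriv i u) (x + r *\<^sub>R y))))
          has_integral - (\<Sum>i\<in>(UNIV::'n set). 0)) (cbox a b)"
        by (intro has_integral_neg has_integral_sum parts) auto
      thus ?thesis
        unfolding axis by (simp add: P_def laplacian_def inner_axis sum.distrib sum_negf sum_subtractf
            sum_distrib_left algebra_simps)
    qed
    moreover have "((\<lambda>y. 4 * P r y) has_integral 4 * integral (cbox a b) (P r)) (cbox a b)"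
      by (intro has_integral_mult_right integrable_integral P_integrable r)
    ultimately have "0 \<le> 4 * integral (cbox a b) (P r)"
    proof (rule has_integral_le)
      fix y assume "y \<in> cbox a b"
      thus "4 * P r y - r * (weight \<rho> y)\<^sup>2 * laplacian u (x + r *\<^sub>R y) \<le> 4 * P r y"
        using r by (simp add: lap mem)
    qed
    thus ?thesis
      by simp
  qed
  have "h 0 \<le> h 1"
  proof (rule DERIV_nonneg_imp_increasing_open[of 0 1 h])
    show "\<exists>y. DERIV h r :> y \<and> 0 \<le> y" if "0 < r" "r < 1" for r
    proof -
      have "at r within {0..1} = at r"
        using that by (intro at_within_interior) auto
      thus ?thesis
        using deriv[of r] nonneg[of r] that by auto
    qed
    show "continuous_on {0..1} h"
      using deriv by (meson DERIV_continuous_on)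
  qed simp
  thus ?thesis
    by (simp add: h_def mult.commute)
qed

text \<open>One weight, fixed once and for all, serves every function and every centre, which is why the
  constant depends on the dimension only.\<close>

lemma subharmonic_le_L1_norm:
  obtains C :: real where "0 < C"
    and "\<And>(u :: real ^ 'n \<Rightarrow> real) \<Omega> T x.
      open \<Omega> \<Longrightarrow> C2_on \<Omega> u \<Longrightarrow> (\<And>z. z \<in> \<Omega> \<Longrightarrow> 0 \<le> laplacian u z) \<Longrightarrow>
      ball x 1 \<subseteq> T \<Longrightarrow> T \<subseteq> \<Omega> \<Longrightarrow> u integrable_on T \<Longrightarrow> (\<And>z. z \<in> T \<Longrightarrow> 0 \<le> u z) \<Longrightarrow>
      u x \<le> C * integral T u"
proof -
  obtain a b :: "real ^ 'n" where Q: "cbox a b \<subseteq> ball 0 1" and 0: "0 \<in> box a b"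
    using open_contains_cbox[of "ball (0 :: real ^ 'n) 1" 0]
    by (metis centre_in_ball open_ball zero_less_one)
  obtain \<rho> where \<rho>: "0 < \<rho>" "cball 0 \<rho> \<subseteq> cbox a b"
    using open_contains_cball_eq[of "box a b"] 0 box_subset_cbox[of a b] by blast
  define W where "W = integral (cbox a b) (weight \<rho>)"
  have "0 < W"
  proof -
    have "0 \<le> W"
      unfolding W_def by (intro integral_nonneg integrable_continuous continuous_intros weight_nonneg)
    moreover have "W \<noteq> 0"
    proof
      assume "W = 0"
      hence "(weight \<rho> has_integral 0) (cbox a b)"
        unfolding W_def by (metis continuous_on_weight integrable_continuous integrable_integral)
      hence "weight \<rho> (0 :: real ^ 'n) = 0"
        by (rule has_integral_0_cbox_imp_0[rotated 2])
          (use 0 box_subset_cbox[of a b] in \<open>auto intro!: continuous_intros weight_nonneg\<close>)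
      thus False
        using \<rho>(1) by (simp add: weight_def max_def split: if_splits)
    qed
    ultimately show ?thesis
      by simp
  qed
  show ?thesis
  proof (rule that[of "\<rho>\<^sup>2 / W"])
    show "0 < \<rho>\<^sup>2 / W"
      using \<open>0 < W\<close> \<rho>(1) by simp
  next
    fix u :: "real ^ 'n \<Rightarrow> real" and \<Omega> T x
    assume \<Omega>: "open \<Omega>" "C2_on \<Omega> u" "\<And>z. z \<in> \<Omega> \<Longrightarrow> 0 \<le> laplacian u z"
      and T: "ball x 1 \<subseteq> T" "T \<subseteq> \<Omega>" and int: "u integrable_on T"
      and nonneg: "\<And>z. z \<in> T \<Longrightarrow> 0 \<le> u z"
    have sub: "cbox (a + x) (b + x) \<subseteq> ball x 1"
    proof
      fix z assume "z \<in> cbox (a + x) (b + x)"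
      hence "z - x \<in> cbox a b"
        by (auto simp: mem_box inner_diff_left inner_add_left algebra_simps)
      thus "z \<in> ball x 1"
        using Q by (auto simp: dist_norm norm_minus_commute)
    qed
    have mem: "x + y \<in> T" if "y \<in> cbox a b" for y
    proof -
      have "x + y \<in> ball x 1"
        using that Q by (auto simp: dist_norm)
      thus ?thesis
        using T(1) by blast
    qed
    have contu: "continuous_on (cbox a b) (\<lambda>y. u (x + y))"
      by (rule continuous_on_compose2[OF C2_on_continuous_on[OF \<Omega>(2)]])
        (use mem T(2) in \<open>auto intro!: continuous_intros\<close>)
    have "u x * W \<le> integral (cbox a b) (\<lambda>y. weight \<rho> y * u (x + y))"
      unfolding W_def by (rule weighted_sub_mean_value) (use \<Omega> T \<rho> Q in auto)
    also have "\<dots> \<le> integral (cbox a b) (\<lambda>y. \<rho>\<^sup>2 * u (x + y))"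
      by (intro integral_le integrable_continuous continuous_intros contu mult_right_mono weight_le
          nonneg mem)
    also have "\<dots> = \<rho>\<^sup>2 * integral (cbox (a + x) (b + x)) u"
      using integral_shift_cbox[of "a + x" x "b + x" u] by (simp add: add.commute)
    also have "\<dots> \<le> \<rho>\<^sup>2 * integral T u"
    proof (rule mult_left_mono[OF integral_subset_le])
      show "u integrable_on cbox (a + x) (b + x)"
        using sub T
        by (intro integrable_continuous continuous_on_subset[OF C2_on_continuous_on[OF \<Omega>(2)]]) auto
    qed (use sub T int nonneg in auto)
    finally show "u x \<le> \<rho>\<^sup>2 / W * integral T u"
      using \<open>0 < W\<close> by (simp add: field_simps)
  qed
qed

section \<open>Passing to the limit\<close>

text \<open>The positive part of \<open>f - d\<close> is at most \<open>\<bar>g m - f\<bar> + \<bar>c m - d\<bar>\<close> for each \<open>m\<close>, so its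
  integral is bounded by a sequence tending to zero.\<close>

lemma (in finite_measure) AE_le_of_L1_limit:
  fixes f :: "'a \<Rightarrow> real"
  assumes int: "integrable M f" "\<And>m. integrable M (g m)"
    and lim: "(\<lambda>m. \<integral>x. \<bar>g m x - f x\<bar> \<partial>M) \<longlonglongrightarrow> 0"
    and le: "\<And>m x. x \<in> space M \<Longrightarrow> g m x \<le> c m" and c: "c \<longlonglongrightarrow> d"
  shows "AE x in M. f x \<le> d"
proof -
  have "(\<lambda>m. (\<integral>x. \<bar>g m x - f x\<bar> \<partial>M) + measure M (space M) * \<bar>c m - d\<bar>)
      \<longlonglongrightarrow> 0 + measure M (space M) * \<bar>d - d\<bar>"
    by (intro tendsto_intros lim c)
  moreover have "(\<integral>x. max 0 (f x - d) \<partial>M)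
      \<le> (\<integral>x. \<bar>g m x - f x\<bar> \<partial>M) + measure M (space M) * \<bar>c m - d\<bar>" for m
  proof -
    have "(\<integral>x. max 0 (f x - d) \<partial>M) \<le> (\<integral>x. \<bar>g m x - f x\<bar> + \<bar>c m - d\<bar> \<partial>M)"
    proof (rule integral_mono)
      show "max 0 (f x - d) \<le> \<bar>g m x - f x\<bar> + \<bar>c m - d\<bar>" if "x \<in> space M" for x
        using le[OF that, of m] by linarith
    qed (use int in auto)
    also have "\<dots> = (\<integral>x. \<bar>g m x - f x\<bar> \<partial>M) + measure M (space M) * \<bar>c m - d\<bar>"
      using int by (subst Bochner_Integration.integral_add) auto
    finally show ?thesis .
  qed
  ultimately have "(\<integral>x. max 0 (f x - d) \<partial>M) \<le> 0"
    by (intro LIMSEQ_le_const[where X = "\<lambda>m. (\<integral>x. \<bar>g m x - f x\<bar> \<partial>M) + measure M (space M) * \<bar>c m - d\<bar>"]) auto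
  moreover have "0 \<le> (\<integral>x. max 0 (f x - d) \<partial>M)"
    by simp
  ultimately have "(\<integral>x. max 0 (f x - d) \<partial>M) = 0"
    by simp
  hence "AE x in M. max 0 (f x - d) = 0"
    using int by (subst (asm) integral_nonneg_eq_0_iff_AE) auto
  thus ?thesis
    by eventually_elim (simp add: max_def split: if_splits)
qed

lemma set_integrable_continuous_compact:
  fixes f :: "'a::euclidean_space \<Rightarrow> real"
  assumes "compact K" "continuous_on K f"
  shows "set_integrable lebesgue K f"
  using borel_integrable_compact[OF assms] unfolding set_integrable_def
  by (intro integrable_completion[THEN iffD2]) auto

theorem lemma5p1:
  fixes k :: nat
  assumes "3 \<le> CARD('n::finite)" and "1 \<le> k" and "real k \<le> real CARD('n) / 2"
  shows "\<exists>C::real. 0 < C \<and>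
    (\<forall>v \<in> Phi k (ball (0 :: real ^ 'n) 3).
       esssup (lebesgue_on (ball (0 :: real ^ 'n) 1)) (\<lambda>x. ereal (v x))
         \<le> ereal (C * (LINT x:ball (0 :: real ^ 'n) 2|lebesgue. \<bar>v x\<bar>)))"
proof -
  obtain C :: real where C: "0 < C"
    and sub_mean: "\<And>(u :: real ^ 'n \<Rightarrow> real) \<Omega> T x.
      open \<Omega> \<Longrightarrow> C2_on \<Omega> u \<Longrightarrow> (\<And>z. z \<in> \<Omega> \<Longrightarrow> 0 \<le> laplacian u z) \<Longrightarrow>
      ball x 1 \<subseteq> T \<Longrightarrow> T \<subseteq> \<Omega> \<Longrightarrow> u integrable_on T \<Longrightarrow> (\<And>z. z \<in> T \<Longrightarrow> 0 \<le> u z) \<Longrightarrow>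
      u x \<le> C * integral T u"
    by (rule subharmonic_le_L1_norm) blast
  define N where "N f = (LINT x:ball (0 :: real ^ 'n) 2|lebesgue. \<bar>f x\<bar> :: real)" for f
  show ?thesis
  proof (intro exI conjI ballI)
    fix v assume "v \<in> Phi k (ball (0 :: real ^ 'n) 3)"
    then obtain us where v: "v \<in> L1_loc (ball 0 3)" and us: "\<And>m. us m \<in> Phi_tilde k (ball 0 3)"
      and lim: "tendsto_L1_loc (ball 0 3) us v"
      by (auto simp: Phi_def)
    have cball_in_ball: "cball (0 :: real ^ 'n) r \<subseteq> ball 0 3" if "r < 3" for r
      using that by auto
    have v_int: "set_integrable lebesgue (cball 0 r) v" if "r < 3" for r
      using v cball_in_ball[OF that] by (simp add: L1_loc_def)
    have u_int: "set_integrable lebesgue (cball 0 r) (us m)" if "r < 3" for r m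
    proof (rule set_integrable_continuous_compact)
      have "continuous_on (ball 0 3) (us m)"
        using us[of m] by (simp add: Phi_tilde_def C2_on_continuous_on)
      thus "continuous_on (cball 0 r) (us m)"
        by (rule continuous_on_subset) (use that in auto)
    qed simp
    have lim': "(\<lambda>m. LINT x:cball 0 r|lebesgue. \<bar>us m x - v x\<bar>) \<longlonglongrightarrow> 0" if "r < 3" for r
      using lim cball_in_ball[OF that] by (simp add: tendsto_L1_loc_def)
    have ball2: "set_integrable lebesgue (ball 0 2) (us m)" "set_integrable lebesgue (ball 0 2) v" for m
      using u_int[of 2 m] v_int[of 2] by (auto elim!: set_integrable_subset)
    have bound: "us m x \<le> C * N (us m)" if "x \<in> cball 0 1" for m x
    proof -
      have pos: "0 < us m z" if "z \<in> ball 0 3" for z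
        using us[of m] that by (auto simp: Phi_tilde_def)
      have "us m x \<le> C * integral (ball 0 2) (us m)"
      proof (rule sub_mean[of "ball 0 3"])
        show "C2_on (ball 0 3) (us m)"
          using us by (simp add: Phi_tilde_def)
        show "0 \<le> laplacian (us m) z" if "z \<in> ball 0 3" for z
          using Phi_tilde_imp_laplacian_nonneg[OF \<open>1 \<le> k\<close> us that] .
        show "ball x 1 \<subseteq> ball 0 2"
          using that by (auto simp: ball_subset_ball_iff)
        show "us m integrable_on ball 0 2"
          using ball2(1) by (rule set_lebesgue_integral_eq_integral)
        show "0 \<le> us m z" if "z \<in> ball 0 2" for z
          using pos[of z] that by simp
      qed auto
      also have "integral (ball 0 2) (us m) = (LINT x:ball 0 2|lebesgue. us m x)"
        using set_lebesgue_integral_eq_integral(2)[OF ball2(1)] by simp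
      also have "\<dots> = N (us m)"
        unfolding N_def by (rule set_lebesgue_integral_cong) (auto simp: abs_of_pos pos)
      finally show ?thesis .
    qed
    have N_lim: "(\<lambda>m. N (us m)) \<longlonglongrightarrow> N v"
    proof -
      have "\<bar>N (us m) - N v\<bar> \<le> (LINT x:cball 0 2|lebesgue. \<bar>us m x - v x\<bar>)" for m
      proof -
        have int: "set_integrable lebesgue (cball 0 2) (\<lambda>x. \<bar>us m x - v x\<bar>)"
          using u_int[of 2 m] v_int[of 2] by (intro set_integrable_abs set_integral_diff) auto
        have int': "set_integrable lebesgue (ball 0 2) (\<lambda>x. \<bar>us m x - v x\<bar>)"
          using int by (rule set_integrable_subset) auto
        have "N (us m) - N v = (LINT x:ball 0 2|lebesgue. \<bar>us m x\<bar> - \<bar>v x\<bar>)"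
          unfolding N_def by (intro set_integral_diff(2)[symmetric] set_integrable_abs ball2)
        also have "\<bar>\<dots>\<bar> \<le> (LINT x:ball 0 2|lebesgue. \<bar>us m x - v x\<bar>)"
        proof -
          have "\<bar>LINT x:ball 0 2|lebesgue. \<bar>us m x\<bar> - \<bar>v x\<bar>\<bar>
              \<le> (LINT x:ball 0 2|lebesgue. \<bar>\<bar>us m x\<bar> - \<bar>v x\<bar>\<bar>)"
            using set_integral_norm_bound[OF set_integral_diff(1)[OF
                set_integrable_abs[OF ball2(1)] set_integrable_abs[OF ball2(2)]]] by simp
          also have "\<dots> \<le> (LINT x:ball 0 2|lebesgue. \<bar>us m x - v x\<bar>)"
            by (intro set_integral_mono set_integrable_abs set_integral_diff(1) int' ball2) auto
          finally show ?thesis .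
        qed
        also have "\<dots> \<le> (LINT x:cball 0 2|lebesgue. \<bar>us m x - v x\<bar>)"
          unfolding set_lebesgue_integral_def
          by (rule integral_mono)
            (use int int' in \<open>auto simp: set_integrable_def indicator_def\<close>)
        finally show ?thesis .
      qed
      hence "(\<lambda>m. N (us m) - N v) \<longlonglongrightarrow> 0"
        by (intro Lim_null_comparison[OF _ lim'[of 2]]) auto
      thus ?thesis
        by (simp add: LIM_zero_iff)
    qed
    have restrict: "integrable (lebesgue_on (cball 0 1)) f = set_integrable lebesgue (cball 0 1) f"
      "integral\<^sup>L (lebesgue_on (cball 0 1)) f = (LINT x:cball 0 1|lebesgue. f x)"
      for f :: "real ^ 'n \<Rightarrow> real"
      by (simp_all add: integrable_restrict_space integral_restrict_space set_integrable_def
          set_lebesgue_integral_def)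
    interpret finite_measure "lebesgue_on (cball (0 :: real ^ 'n) 1)"
      by (rule finite_measure_lebesgue_on) simp
    have "AE x in lebesgue_on (cball 0 1). v x \<le> C * N v"
      by (rule AE_le_of_L1_limit[where g = us and c = "\<lambda>m. C * N (us m)"])
        (auto simp: restrict v_int u_int lim' bound intro!: tendsto_intros N_lim)
    hence AE: "AE x in lebesgue_on (ball 0 1). v x \<le> C * N v"
      by (auto simp: AE_restrict_space_iff)
    have "set_integrable lebesgue (ball 0 1) v"
      using v_int[of 1] by (rule set_integrable_subset) auto
    hence "integrable (lebesgue_on (ball 0 1)) v"
      by (simp add: integrable_restrict_space set_integrable_def)
    hence meas: "v \<in> borel_measurable (lebesgue_on (ball 0 1))"
      by auto
    show "esssup (lebesgue_on (ball (0 :: real ^ 'n) 1)) (\<lambda>x. ereal (v x))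
         \<le> ereal (C * (LINT x:ball (0 :: real ^ 'n) 2|lebesgue. \<bar>v x\<bar>))"
      using AE meas by (intro esssup_I) (auto simp: N_def)
  qed (rule C)
qed

end
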